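(* Let $(X,\widehat d_X)$ and $(Y,\widehat d_Y)$ be two non-Archimedean metric spaces such that every ball in $X$ and every ball in $Y$ contains at least two distinct elements. Let $P_1,P_2\in\mathfrak D_\flat(X,Y)$ with $P_1\ne P_2$. Then: (1) $\widehat\beta_{X,Y}^{0}(P_1,P_2)=\widehat\rho_s(P_1,P_2)$ if and only if $\max\{d_a(P_1),d_a(P_2)\}\le\widehat\rho_s(P_1,P_2)$. (2) $\widehat\beta_{X,Y}^{\infty}(P_1,P_2)=\widehat\Omega_{X,Y}(P_1,P_2)$. (3) $\widehat\beta_{X,Y}^{\ast0}(P_1,P_2)=\widehat\rho_s(P_1,P_2)$. (4) $\widehat\beta_{X,Y}^{\ast\infty}(P_1,P_2)=\widehat\Omega_{X,Y}^{\ast}(P_1,P_2)$.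
   Context: Metrics may take the value $+\infty$, and $\inf\emptyset=+\infty$. A metric $\widehat d$ is non-Archimedean if $\widehat d(x,z)\le\max\{\widehat d(x,y),\widehat d(y,z)\}$. A ball in $X$ is a set $\{x:\widehat d_X(a,x)<r\}$ or $\{x:\widehat d_X(a,x)\le r\}$ with $a\in X$, $0<r<\infty$; $\mathcal M_\flat(X)$ is the set of all balls in $X$. For $B\in\mathcal M_\flat(X)$ and $\varepsilon>0$, $B^{\varepsilon}=\{x\in X:\operatorname{dist}(x,B)<\varepsilon\}$ with $\operatorname{dist}(x,B)=\inf_{b\in B}\widehat d_X(x,b)$; it is again a ball in $X$. $\mathfrak D_\flat(X,Y)$ is the set of all maps $P:\mathcal M_\flat(X)\to Y$. $\widehat\rho_s(P_1,P_2)=\sup_{B\in\mathcal M_\flat(X)}\widehat d_Y(P_1(B),P_2(B))$. For $\lambda>0$ and $P_1\ne P_2$, $\widehat\beta_{X,Y}^{\lambda}(P_1,P_2)$ is the infimum of all $\varepsilon>0$ such that $\widehat d_Y(P_1(B),P_2(B^{\lambda\varepsilon}))\le\varepsilon$ and $\widehat d_Y(P_2(B),P_1(B^{\lambda\varepsilon}))\le\varepsilon$ for all $B\in\mathcal M_\flat(X)$. $\widehat\beta_{X,Y}^{\ast\lambda}(P_1,P_2)$ is the infimum of all $\varepsilon>0$ such that for every $B\in\mathcal M_\flat(X)$ there exist positive numbers $\varepsilon_B,\varepsilon_B'\le\varepsilon$ with $\widehat d_Y(P_1(B),P_2(B^{\lambda\varepsilon_B}))\le\varepsilon$ and $\widehat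 d_Y(P_2(B),P_1(B^{\lambda\varepsilon_B'}))\le\varepsilon$. $\widehat\beta_{X,Y}^{0}=\inf_{\lambda>0}\widehat\beta_{X,Y}^{\lambda}$, $\widehat\beta_{X,Y}^{\infty}=\sup_{\lambda>0}\widehat\beta_{X,Y}^{\lambda}$, $\widehat\beta_{X,Y}^{\ast0}=\sup_{\lambda>0}\widehat\beta_{X,Y}^{\ast\lambda}$, $\widehat\beta_{X,Y}^{\ast\infty}=\inf_{\lambda>0}\widehat\beta_{X,Y}^{\ast\lambda}$ (pointwise in $(P_1,P_2)$). For $\varepsilon>0$, $P$ is $\varepsilon$-admissible if there is $\delta>0$ with $\widehat d_Y(P(B),P(B^{\delta}))\le\varepsilon$ for all $B\in\mathcal M_\flat(X)$; $d_a(P)=\inf\{\varepsilon>0:P\text{ is }\varepsilon\text{-admissible}\}$. For $P_1\ne P_2$ and $\varepsilon>0$, $O_\varepsilon(P_1,P_2)$ is the set of all $\delta>0$ with $\widehat d_Y(P_1(B),P_2(B^{\delta}))\le\varepsilon$ and $\widehat d_Y(P_2(B),P_1(B^{\delta}))\le\varepsilon$ for all $B\in\mathcal M_\flat(X)$; $\Omega_\varepsilon(P_1,P_2)=\sup O_\varepsilon(P_1,P_2)$, with $\Omega_\varepsilon(P_1,P_2)=0$ if $O_\varepsilon(P_1,P_2)=\emptyset$; $\widehat\Omega_{X,Y}(P_1,P_2)=\inf\{\varepsilon>0:\Omega_\varepsilon(P_1,P_2)=\infty\}$, with $\widehat\Omega_{X,Y}(P_1,P_2)=\infty$ if $\Omega_\varepsilon(P_1,P_2)=0$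 for all $\varepsilon>0$. $O_\varepsilon^{\ast}(P_1\to P_2)$ is the set of all $\delta>0$ such that for every $B\in\mathcal M_\flat(X)$ there is a positive number $\delta_B\le\delta$ with $\widehat d_Y(P_1(B),P_2(B^{\delta_B}))\le\varepsilon$; $\widehat\Omega_{X,Y}^{\ast}(P_1,P_2)=\inf\{\varepsilon>0:O_\varepsilon^{\ast}(P_1\to P_2)\cap O_\varepsilon^{\ast}(P_2\to P_1)\ne\emptyset\}$. *)

theory Defs
  imports "HOL-Library.Extended_Nonnegative_Real" "HOL-Library.FuncSet"
begin

text \<open>
  Distances take values in \<^typ>\<open>ennreal\<close>, where \<open>Inf {} = top\<close> and \<open>Sup {} = 0\<close>. Radii and the
  parameters \<open>\<epsilon>\<close>, \<open>\<delta>\<close> and \<open>lam\<close> are finite and range over the positive reals.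
\<close>

locale ext_metric_space =
  fixes X :: "'a set" and d :: "'a \<Rightarrow> 'a \<Rightarrow> ennreal"
  assumes zero_iff: "\<lbrakk>x \<in> X; y \<in> X\<rbrakk> \<Longrightarrow> d x y = 0 \<longleftrightarrow> x = y"
    and sym: "\<lbrakk>x \<in> X; y \<in> X\<rbrakk> \<Longrightarrow> d x y = d y x"
    and triangle: "\<lbrakk>x \<in> X; y \<in> X; z \<in> X\<rbrakk> \<Longrightarrow> d x z \<le> d x y + d y z"

locale nonarch_metric_space = ext_metric_space +
  assumes strong_triangle: "\<lbrakk>x \<in> X; y \<in> X; z \<in> X\<rbrakk> \<Longrightarrow> d x z \<le> max (d x y) (d y z)"

definition metric_balls :: "'a set \<Rightarrow> ('a \<Rightarrow> 'a \<Rightarrow> ennreal) \<Rightarrow> 'a set set" where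
  "metric_balls X d =
     {B. \<exists>a\<in>X. \<exists>r::real. 0 < r \<and>
        (B = {x \<in> X. d a x < ennreal r} \<or> B = {x \<in> X. d a x \<le> ennreal r})}"

definition set_dist :: "('a \<Rightarrow> 'a \<Rightarrow> ennreal) \<Rightarrow> 'a \<Rightarrow> 'a set \<Rightarrow> ennreal" where
  "set_dist d x B = (INF b\<in>B. d x b)"

definition enlarge :: "'a set \<Rightarrow> ('a \<Rightarrow> 'a \<Rightarrow> ennreal) \<Rightarrow> 'a set \<Rightarrow> real \<Rightarrow> 'a set" where
  "enlarge X d B \<epsilon> = {x \<in> X. set_dist d x B < ennreal \<epsilon>}"

lemma (in nonarch_metric_space) enlarge_in_metric_balls:
  assumes B: "B \<in> metric_balls X d" and "0 < \<epsilon>"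
  shows "enlarge X d B \<epsilon> \<in> metric_balls X d"
proof -
  obtain a r where a: "a \<in> X" and r: "0 < r"
    and Br: "B = {x \<in> X. d a x < ennreal r} \<or> B = {x \<in> X. d a x \<le> ennreal r}"
    using B unfolding metric_balls_def by blast
  have BX: "B \<subseteq> X" using Br by auto
  have aB: "a \<in> B" using Br a r zero_iff[OF a a] by auto
  have mem: "x \<in> enlarge X d B \<epsilon> \<longleftrightarrow> x \<in> X \<and> (\<exists>b\<in>B. d x b < ennreal \<epsilon>)" for x
    by (auto simp: enlarge_def set_dist_def INF_less_iff)
  show ?thesis
  proof (cases "\<epsilon> \<le> r")
    case True
    have "x \<in> B" if "x \<in> X" "b \<in> B" "d x b < ennreal \<epsilon>" for x b
    proof -
      have b: "b \<in> X" using that BX by auto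
      have "d a x \<le> max (d a b) (d x b)"
        using strong_triangle[OF a b that(1)] sym[OF b that(1)] by simp
      moreover have "d x b < ennreal r"
        using that(3) True by (meson ennreal_leI order_less_le_trans)
      ultimately show ?thesis using Br that by (auto simp: le_max_iff_disj)
    qed
    moreover have "d x x < ennreal \<epsilon>" if "x \<in> B" for x
      using zero_iff[of x x] that BX \<open>0 < \<epsilon>\<close> by auto
    ultimately have "enlarge X d B \<epsilon> = B" using mem BX by blast
    then show ?thesis using B by simp
  next
    case False
    have "d a x < ennreal \<epsilon>" if "x \<in> X" "b \<in> B" "d x b < ennreal \<epsilon>" for x b
    proof -
      have b: "b \<in> X" using that BX by auto
      have "d a x \<le> max (d a b) (d x b)"
        using strong_triangle[OF a b that(1)] sym[OF b that(1)] by simp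
      moreover have "d a b \<le> ennreal r" using Br that by auto
      then have "d a b < ennreal \<epsilon>"
        using False r by (meson ennreal_lessI le_less_trans less_trans not_le)
      ultimately show ?thesis using that(3) by (auto simp: le_max_iff_disj)
    qed
    then have "enlarge X d B \<epsilon> = {x \<in> X. d a x < ennreal \<epsilon>}"
      using mem aB sym[OF a] by (auto intro!: bexI[of _ a])
    then show ?thesis using a \<open>0 < \<epsilon>\<close> unfolding metric_balls_def by blast
  qed
qed

text \<open>
  The maps are extensional off the set of balls, so that \<open>P\<^sub>1 \<noteq> P\<^sub>2\<close> means that they differ at some ball.
\<close>

definition ball_maps ::
  "'a set \<Rightarrow> ('a \<Rightarrow> 'a \<Rightarrow> ennreal) \<Rightarrow> 'b set \<Rightarrow> ('a set \<Rightarrow> 'b) set" where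
  "ball_maps X dX Y = metric_balls X dX \<rightarrow>\<^sub>E Y"

definition rho_s ::
  "'a set \<Rightarrow> ('a \<Rightarrow> 'a \<Rightarrow> ennreal) \<Rightarrow> ('b \<Rightarrow> 'b \<Rightarrow> ennreal) \<Rightarrow>
    ('a set \<Rightarrow> 'b) \<Rightarrow> ('a set \<Rightarrow> 'b) \<Rightarrow> ennreal" where
  "rho_s X dX dY P1 P2 = (SUP B\<in>metric_balls X dX. dY (P1 B) (P2 B))"

text \<open>
  The functionals \<open>beta\<close> and \<open>Omega_hat\<close>, and those derived from them, are meant for
  \<open>P1 \<noteq> P2\<close> only; no separate value is fixed at \<open>P1 = P2\<close>.
\<close>

definition beta ::
  "'a set \<Rightarrow> ('a \<Rightarrow> 'a \<Rightarrow> ennreal) \<Rightarrow> ('b \<Rightarrow> 'b \<Rightarrow> ennreal) \<Rightarrow> real \<Rightarrow>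
    ('a set \<Rightarrow> 'b) \<Rightarrow> ('a set \<Rightarrow> 'b) \<Rightarrow> ennreal" where
  "beta X dX dY lam P1 P2 =
     (INF \<epsilon>\<in>{\<epsilon>::real. 0 < \<epsilon> \<and> (\<forall>B\<in>metric_balls X dX.
          dY (P1 B) (P2 (enlarge X dX B (lam * \<epsilon>))) \<le> ennreal \<epsilon> \<and>
          dY (P2 B) (P1 (enlarge X dX B (lam * \<epsilon>))) \<le> ennreal \<epsilon>)}. ennreal \<epsilon>)"

definition beta_star ::
  "'a set \<Rightarrow> ('a \<Rightarrow> 'a \<Rightarrow> ennreal) \<Rightarrow> ('b \<Rightarrow> 'b \<Rightarrow> ennreal) \<Rightarrow> real \<Rightarrow>
    ('a set \<Rightarrow> 'b) \<Rightarrow> ('a set \<Rightarrow> 'b) \<Rightarrow> ennreal" where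
  "beta_star X dX dY lam P1 P2 =
     (INF \<epsilon>\<in>{\<epsilon>::real. 0 < \<epsilon> \<and> (\<forall>B\<in>metric_balls X dX. \<exists>\<epsilon>\<^sub>B \<epsilon>\<^sub>B'.
          0 < \<epsilon>\<^sub>B \<and> \<epsilon>\<^sub>B \<le> \<epsilon> \<and> 0 < \<epsilon>\<^sub>B' \<and> \<epsilon>\<^sub>B' \<le> \<epsilon> \<and>
          dY (P1 B) (P2 (enlarge X dX B (lam * \<epsilon>\<^sub>B))) \<le> ennreal \<epsilon> \<and>
          dY (P2 B) (P1 (enlarge X dX B (lam * \<epsilon>\<^sub>B'))) \<le> ennreal \<epsilon>)}. ennreal \<epsilon>)"

definition beta_0 ::
  "'a set \<Rightarrow> ('a \<Rightarrow> 'a \<Rightarrow> ennreal) \<Rightarrow> ('b \<Rightarrow> 'b \<Rightarrow> ennreal) \<Rightarrow>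
    ('a set \<Rightarrow> 'b) \<Rightarrow> ('a set \<Rightarrow> 'b) \<Rightarrow> ennreal" where
  "beta_0 X dX dY P1 P2 = (INF lam\<in>{0<..}. beta X dX dY lam P1 P2)"

definition beta_inf ::
  "'a set \<Rightarrow> ('a \<Rightarrow> 'a \<Rightarrow> ennreal) \<Rightarrow> ('b \<Rightarrow> 'b \<Rightarrow> ennreal) \<Rightarrow>
    ('a set \<Rightarrow> 'b) \<Rightarrow> ('a set \<Rightarrow> 'b) \<Rightarrow> ennreal" where
  "beta_inf X dX dY P1 P2 = (SUP lam\<in>{0<..}. beta X dX dY lam P1 P2)"

text \<open>For the starred family the roles of supremum and infimum are exchanged.\<close>

definition beta_star_0 ::
  "'a set \<Rightarrow> ('a \<Rightarrow> 'a \<Rightarrow> ennreal) \<Rightarrow> ('b \<Rightarrow> 'b \<Rightarrow> ennreal) \<Rightarrow>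
    ('a set \<Rightarrow> 'b) \<Rightarrow> ('a set \<Rightarrow> 'b) \<Rightarrow> ennreal" where
  "beta_star_0 X dX dY P1 P2 = (SUP lam\<in>{0<..}. beta_star X dX dY lam P1 P2)"

definition beta_star_inf ::
  "'a set \<Rightarrow> ('a \<Rightarrow> 'a \<Rightarrow> ennreal) \<Rightarrow> ('b \<Rightarrow> 'b \<Rightarrow> ennreal) \<Rightarrow>
    ('a set \<Rightarrow> 'b) \<Rightarrow> ('a set \<Rightarrow> 'b) \<Rightarrow> ennreal" where
  "beta_star_inf X dX dY P1 P2 = (INF lam\<in>{0<..}. beta_star X dX dY lam P1 P2)"

definition admissible ::
  "'a set \<Rightarrow> ('a \<Rightarrow> 'a \<Rightarrow> ennreal) \<Rightarrow> ('b \<Rightarrow> 'b \<Rightarrow> ennreal) \<Rightarrow> real \<Rightarrow>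
    ('a set \<Rightarrow> 'b) \<Rightarrow> bool" where
  "admissible X dX dY \<epsilon> P \<longleftrightarrow>
     (\<exists>\<delta>>0. \<forall>B\<in>metric_balls X dX. dY (P B) (P (enlarge X dX B \<delta>)) \<le> ennreal \<epsilon>)"

definition d_a ::
  "'a set \<Rightarrow> ('a \<Rightarrow> 'a \<Rightarrow> ennreal) \<Rightarrow> ('b \<Rightarrow> 'b \<Rightarrow> ennreal) \<Rightarrow> ('a set \<Rightarrow> 'b) \<Rightarrow> ennreal" where
  "d_a X dX dY P = (INF \<epsilon>\<in>{\<epsilon>::real. 0 < \<epsilon> \<and> admissible X dX dY \<epsilon> P}. ennreal \<epsilon>)"

definition O_set ::
  "'a set \<Rightarrow> ('a \<Rightarrow> 'a \<Rightarrow> ennreal) \<Rightarrow> ('b \<Rightarrow> 'b \<Rightarrow> ennreal) \<Rightarrow> real \<Rightarrow>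
    ('a set \<Rightarrow> 'b) \<Rightarrow> ('a set \<Rightarrow> 'b) \<Rightarrow> real set" where
  "O_set X dX dY \<epsilon> P1 P2 =
     {\<delta>. 0 < \<delta> \<and> (\<forall>B\<in>metric_balls X dX.
          dY (P1 B) (P2 (enlarge X dX B \<delta>)) \<le> ennreal \<epsilon> \<and>
          dY (P2 B) (P1 (enlarge X dX B \<delta>)) \<le> ennreal \<epsilon>)}"

text \<open>
  \<open>Omega_eps\<close> is \<open>0\<close> when \<open>O_set\<close> is empty. Hence, if it is \<open>0\<close> for all \<open>\<epsilon> > 0\<close>, the infimum
  in \<open>Omega_hat\<close> is over the empty set and equals \<open>top\<close>, as the convention for that case requires.
\<close>

definition Omega_eps ::
  "'a set \<Rightarrow> ('a \<Rightarrow> 'a \<Rightarrow> ennreal) \<Rightarrow> ('b \<Rightarrow> 'b \<Rightarrow> ennreal) \<Rightarrow> real \<Rightarrow>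
    ('a set \<Rightarrow> 'b) \<Rightarrow> ('a set \<Rightarrow> 'b) \<Rightarrow> ennreal" where
  "Omega_eps X dX dY \<epsilon> P1 P2 = (SUP \<delta>\<in>O_set X dX dY \<epsilon> P1 P2. ennreal \<delta>)"

definition Omega_hat ::
  "'a set \<Rightarrow> ('a \<Rightarrow> 'a \<Rightarrow> ennreal) \<Rightarrow> ('b \<Rightarrow> 'b \<Rightarrow> ennreal) \<Rightarrow>
    ('a set \<Rightarrow> 'b) \<Rightarrow> ('a set \<Rightarrow> 'b) \<Rightarrow> ennreal" where
  "Omega_hat X dX dY P1 P2 =
     (INF \<epsilon>\<in>{\<epsilon>::real. 0 < \<epsilon> \<and> Omega_eps X dX dY \<epsilon> P1 P2 = top}. ennreal \<epsilon>)"

definition O_star ::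
  "'a set \<Rightarrow> ('a \<Rightarrow> 'a \<Rightarrow> ennreal) \<Rightarrow> ('b \<Rightarrow> 'b \<Rightarrow> ennreal) \<Rightarrow> real \<Rightarrow>
    ('a set \<Rightarrow> 'b) \<Rightarrow> ('a set \<Rightarrow> 'b) \<Rightarrow> real set" where
  "O_star X dX dY \<epsilon> P1 P2 =
     {\<delta>. 0 < \<delta> \<and> (\<forall>B\<in>metric_balls X dX. \<exists>\<delta>\<^sub>B. 0 < \<delta>\<^sub>B \<and> \<delta>\<^sub>B \<le> \<delta> \<and>
          dY (P1 B) (P2 (enlarge X dX B \<delta>\<^sub>B)) \<le> ennreal \<epsilon>)}"

definition Omega_star ::
  "'a set \<Rightarrow> ('a \<Rightarrow> 'a \<Rightarrow> ennreal) \<Rightarrow> ('b \<Rightarrow> 'b \<Rightarrow> ennreal) \<Rightarrow>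
    ('a set \<Rightarrow> 'b) \<Rightarrow> ('a set \<Rightarrow> 'b) \<Rightarrow> ennreal" where
  "Omega_star X dX dY P1 P2 =
     (INF \<epsilon>\<in>{\<epsilon>::real. 0 < \<epsilon> \<and>
        O_star X dX dY \<epsilon> P1 P2 \<inter> O_star X dX dY \<epsilon> P2 P1 \<noteq> {}}. ennreal \<epsilon>)"

end

theory Submission
  imports Defs
begin

text \<open>
  In a non-Archimedean space a ball \<open>B\<close> of radius \<open>r\<close> is not changed by \<open>\<epsilon>\<close>-enlargement for
  \<open>\<epsilon> \<le> r\<close>, and enlargements absorb each other: \<open>(B\<^sup>\<epsilon>)\<^sup>\<delta> = B\<^sup>\<delta>\<close> for \<open>\<epsilon> \<le> \<delta>\<close>. The
  first three claims rest on these facts; the last one is a substitution of variables.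

  Write \<open>P \<rightarrow> Q\<close> at \<open>(\<epsilon>, \<delta>)\<close> if \<open>P B\<close> and \<open>Q (B\<^sup>\<delta>)\<close> are \<open>\<epsilon>\<close>-close for all balls \<open>B\<close>. If
  \<open>P \<rightarrow> Q\<close> and \<open>R \<rightarrow> Q\<close> at \<open>(\<epsilon>, \<delta>)\<close>, then \<open>P \<rightarrow> R\<close> at \<open>(\<epsilon>, \<delta>')\<close> for every \<open>\<delta>' \<le> \<delta>\<close>,
  since \<open>P B\<close> is close to \<open>Q (B\<^sup>\<delta>) = Q ((B\<^sup>\<delta>')\<^sup>\<delta>)\<close>, which is close to \<open>R (B\<^sup>\<delta>')\<close>
  (lemma \<open>shift_close_join\<close>). Hence the set \<open>O\<^sub>\<epsilon>\<close> is closed under decreasing \<open>\<delta>\<close>, and it is nonempty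
  exactly when \<open>\<rho>\<^sub>s \<le> \<epsilon>\<close> and both maps are \<open>\<epsilon>\<close>-admissible.

  Since \<open>\<beta>\<^sup>\<lambda>\<close> is the infimum of the \<open>\<epsilon>\<close> with \<open>\<lambda>\<epsilon> \<in> O\<^sub>\<epsilon>\<close>, taking the infimum over \<open>\<lambda>\<close> leaves the
  infimum of the \<open>\<epsilon>\<close> with \<open>O\<^sub>\<epsilon> \<noteq> {}\<close>, which is \<open>max \<rho>\<^sub>s (max (d\<^sub>a P\<^sub>1) (d\<^sub>a P\<^sub>2))\<close>. For the
  supremum over \<open>\<lambda>\<close>, one uses that \<open>\<rho>\<^sub>s > 0\<close> when \<open>P\<^sub>1 \<noteq> P\<^sub>2\<close>: as \<open>\<epsilon> \<ge> \<rho>\<^sub>s\<close> whenever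
  \<open>O\<^sub>\<epsilon> \<noteq> {}\<close>, \<open>\<lambda>\<epsilon>\<close> tends to infinity with \<open>\<lambda>\<close>. So if \<open>\<beta>\<^sup>\<lambda> < e\<close> for all \<open>\<lambda>\<close>, then \<open>O\<^sub>e\<close>, which
  contains \<open>O\<^sub>\<epsilon>\<close> for \<open>\<epsilon> \<le> e\<close>, is unbounded; conversely an unbounded \<open>O\<^sub>\<epsilon>\<close> is all of \<open>(0, \<infinity>)\<close>
  and contains \<open>\<lambda>\<epsilon>\<close> for every \<open>\<lambda>\<close>.

  In the starred case the enlargement may be chosen for each ball separately. Small enlargements do
  nothing, so \<open>\<beta>\<^sup>*\<^sup>\<lambda> \<le> \<rho>\<^sub>s\<close>; conversely a fixed ball is not changed by any of the allowed enlargements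
  once \<open>\<lambda>\<close> is small, and the supremum over \<open>\<lambda>\<close> is \<open>\<rho>\<^sub>s\<close>. For the infimum over \<open>\<lambda>\<close>, substituting
  \<open>\<delta> = \<lambda>\<epsilon>\<close> and \<open>\<delta>\<^sub>B = \<lambda>\<epsilon>\<^sub>B\<close> turns one definition into the other.
\<close>

section \<open>Enlargements of balls\<close>

context nonarch_metric_space
begin

lemma mem_enlarge_iff:
  "x \<in> enlarge X d B \<epsilon> \<longleftrightarrow> x \<in> X \<and> (\<exists>b\<in>B. d x b < ennreal \<epsilon>)"
  by (auto simp: enlarge_def set_dist_def INF_less_iff)

lemma metric_ball_subset: "B \<in> metric_balls X d \<Longrightarrow> B \<subseteq> X"
  by (auto simp: metric_balls_def)

text \<open>
  A point at distance less than \<open>r\<close> from a point of a ball of radius \<open>r\<close> already lies in the ball, by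
  the strong triangle inequality.
\<close>

lemma enlarge_small_eq:
  assumes B: "B \<in> metric_balls X d"
  obtains r :: real where "0 < r" and "\<And>\<epsilon>. \<lbrakk>0 < \<epsilon>; \<epsilon> \<le> r\<rbrakk> \<Longrightarrow> enlarge X d B \<epsilon> = B"
proof -
  obtain a r where a: "a \<in> X" and r: "0 < r"
    and Br: "B = {x \<in> X. d a x < ennreal r} \<or> B = {x \<in> X. d a x \<le> ennreal r}"
    using B unfolding metric_balls_def by blast
  have BX: "B \<subseteq> X" using Br by auto
  have "enlarge X d B \<epsilon> = B" if "0 < \<epsilon>" "\<epsilon> \<le> r" for \<epsilon>
  proof -
    have "x \<in> B" if x: "x \<in> X" "b \<in> B" "d x b < ennreal \<epsilon>" for x b
    proof -
      have b: "b \<in> X" using x(2) BX by auto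
      have "d a x \<le> max (d a b) (d x b)"
        using strong_triangle[OF a b x(1)] sym[OF b x(1)] by simp
      moreover have "d x b < ennreal r"
        using x(3) \<open>\<epsilon> \<le> r\<close> by (meson ennreal_leI order_less_le_trans)
      ultimately show ?thesis using Br x(1,2) by (auto simp: le_max_iff_disj)
    qed
    moreover have "d x x < ennreal \<epsilon>" if "x \<in> B" for x
      using zero_iff[of x x] that BX \<open>0 < \<epsilon>\<close> by auto
    ultimately show ?thesis using mem_enlarge_iff BX by blast
  qed
  then show thesis using that r by blast
qed

lemma enlarge_absorb:
  assumes "B \<subseteq> X" "0 < \<epsilon>" "\<epsilon> \<le> \<delta>"
  shows "enlarge X d (enlarge X d B \<epsilon>) \<delta> = enlarge X d B \<delta>"
proof -
  have "\<exists>b\<in>B. d x b < ennreal \<delta>"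
    if "x \<in> X" "y \<in> X" "d x y < ennreal \<delta>" "b \<in> B" "d y b < ennreal \<epsilon>" for x y b
  proof -
    have "d x b \<le> max (d x y) (d y b)"
      using strong_triangle that(1,2,4) assms(1) by blast
    moreover have "d y b < ennreal \<delta>"
      using that(5) assms(3) by (meson ennreal_leI order_less_le_trans)
    ultimately show ?thesis using that(3,4) by (metis max_less_iff_conj order_le_less_trans)
  qed
  moreover have "d b b < ennreal \<epsilon>" if "b \<in> B" for b
    using zero_iff[of b b] that assms by auto
  ultimately show ?thesis
    using assms(1) by (fastforce simp: mem_enlarge_iff)
qed

end

section \<open>Maps that are close up to an enlargement\<close>

locale ball_map_setting =
  X: nonarch_metric_space X dX + Y: nonarch_metric_space Y dY
  for X :: "'a set" and dX :: "'a \<Rightarrow> 'a \<Rightarrow> ennreal"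
    and Y :: "'b set" and dY :: "'b \<Rightarrow> 'b \<Rightarrow> ennreal"
begin

definition shift_close :: "real \<Rightarrow> real \<Rightarrow> ('a set \<Rightarrow> 'b) \<Rightarrow> ('a set \<Rightarrow> 'b) \<Rightarrow> bool" where
  "shift_close \<epsilon> \<delta> P Q \<longleftrightarrow> (\<forall>B\<in>metric_balls X dX. dY (P B) (Q (enlarge X dX B \<delta>)) \<le> ennreal \<epsilon>)"

lemma O_set_iff:
  "\<delta> \<in> O_set X dX dY \<epsilon> P Q \<longleftrightarrow> 0 < \<delta> \<and> shift_close \<epsilon> \<delta> P Q \<and> shift_close \<epsilon> \<delta> Q P"
  by (auto simp: O_set_def shift_close_def)

lemma admissible_iff: "admissible X dX dY \<epsilon> P \<longleftrightarrow> (\<exists>\<delta>>0. shift_close \<epsilon> \<delta> P P)"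
  by (auto simp: admissible_def shift_close_def)

lemma beta_eq:
  assumes "0 < lam"
  shows "beta X dX dY lam P Q = (INF \<epsilon>\<in>{\<epsilon>. 0 < \<epsilon> \<and> lam * \<epsilon> \<in> O_set X dX dY \<epsilon> P Q}. ennreal \<epsilon>)"
  unfolding beta_def O_set_def
  by (rule arg_cong[where f = Inf], rule image_cong) (use assms in auto)

lemma ball_map_in: "\<lbrakk>P \<in> ball_maps X dX Y; B \<in> metric_balls X dX\<rbrakk> \<Longrightarrow> P B \<in> Y"
  by (auto simp: ball_maps_def)

text \<open>Both \<open>P B\<close> and \<open>R (B\<^sup>\<delta>')\<close> are close to \<open>Q (B\<^sup>\<delta>)\<close>, because \<open>(B\<^sup>\<delta>')\<^sup>\<delta> = B\<^sup>\<delta>\<close>.\<close>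

lemma shift_close_join:
  assumes P: "P \<in> ball_maps X dX Y" and Q: "Q \<in> ball_maps X dX Y" and R: "R \<in> ball_maps X dX Y"
    and PQ: "shift_close \<epsilon> \<delta> P Q" and RQ: "shift_close \<epsilon> \<delta> R Q"
    and \<delta>': "0 < \<delta>'" "\<delta>' \<le> \<delta>"
  shows "shift_close \<epsilon> \<delta>' P R"
  unfolding shift_close_def
proof
  fix B assume B: "B \<in> metric_balls X dX"
  let ?C = "enlarge X dX B \<delta>'" and ?D = "enlarge X dX B \<delta>"
  have C: "?C \<in> metric_balls X dX" and D: "?D \<in> metric_balls X dX"
    using B \<delta>' by (auto intro: X.enlarge_in_metric_balls)
  have CD: "enlarge X dX ?C \<delta> = ?D"
    using X.enlarge_absorb X.metric_ball_subset B \<delta>' by blast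
  have "dY (P B) (R ?C) \<le> max (dY (P B) (Q ?D)) (dY (Q ?D) (R ?C))"
    using Y.strong_triangle ball_map_in P Q R B C D by blast
  also have "dY (Q ?D) (R ?C) = dY (R ?C) (Q ?D)"
    using Y.sym ball_map_in Q R C D by blast
  also have "max (dY (P B) (Q ?D)) (dY (R ?C) (Q ?D)) \<le> ennreal \<epsilon>"
    using PQ RQ B C CD unfolding shift_close_def by (metis max.bounded_iff)
  finally show "dY (P B) (R ?C) \<le> ennreal \<epsilon>" .
qed

text \<open>Apply the joining property with an enlargement so small that it does not change the ball.\<close>

lemma dist_le_of_shift_close:
  assumes "P \<in> ball_maps X dX Y" "Q \<in> ball_maps X dX Y" "R \<in> ball_maps X dX Y"
    and "shift_close \<epsilon> \<delta> P Q" "shift_close \<epsilon> \<delta> R Q" "0 < \<delta>" and B: "B \<in> metric_balls X dX"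
  shows "dY (P B) (R B) \<le> ennreal \<epsilon>"
proof -
  obtain r where r: "0 < r" "\<And>\<epsilon>. \<lbrakk>0 < \<epsilon>; \<epsilon> \<le> r\<rbrakk> \<Longrightarrow> enlarge X dX B \<epsilon> = B"
    using X.enlarge_small_eq[OF B] by blast
  have "shift_close \<epsilon> (min r \<delta>) P R"
    using shift_close_join[of P Q R \<epsilon> \<delta> "min r \<delta>"] assms r(1) by simp
  then show ?thesis
    using B r \<open>0 < \<delta>\<close> unfolding shift_close_def by force
qed

lemma shift_close_mono: "\<lbrakk>shift_close \<epsilon> \<delta> P Q; \<epsilon> \<le> \<epsilon>'\<rbrakk> \<Longrightarrow> shift_close \<epsilon>' \<delta> P Q"
  unfolding shift_close_def by (meson ennreal_leI order_trans)

lemma O_set_mono: "\<lbrakk>\<delta> \<in> O_set X dX dY \<epsilon> P Q; \<epsilon> \<le> \<epsilon>'\<rbrakk> \<Longrightarrow> \<delta> \<in> O_set X dX dY \<epsilon>' P Q"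
  by (auto simp: O_set_iff intro: shift_close_mono)

lemma admissible_mono:
  "\<lbrakk>admissible X dX dY \<epsilon> P; \<epsilon> \<le> \<epsilon>'\<rbrakk> \<Longrightarrow> admissible X dX dY \<epsilon>' P"
  by (auto simp: admissible_iff intro: shift_close_mono)

end

section \<open>The sets of common shifts of a pair of maps\<close>

locale ball_map_pair = ball_map_setting X dX Y dY
  for X :: "'a set" and dX :: "'a \<Rightarrow> 'a \<Rightarrow> ennreal"
    and Y :: "'b set" and dY :: "'b \<Rightarrow> 'b \<Rightarrow> ennreal" +
  fixes P Q :: "'a set \<Rightarrow> 'b"
  assumes P: "P \<in> ball_maps X dX Y" and Q: "Q \<in> ball_maps X dX Y"
begin

text \<open>
  Joining \<open>P \<rightarrow> Q\<close> with itself gives \<open>P \<rightarrow> P\<close>. So each map in the pair is close to its own shift, and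
  this in turn allows the shift between the two maps to be decreased.
\<close>

lemma O_set_imp_self:
  assumes "\<delta> \<in> O_set X dX dY \<epsilon> P Q"
  shows "shift_close \<epsilon> \<delta> P P" "shift_close \<epsilon> \<delta> Q Q"
  using assms shift_close_join[OF P Q P, of \<epsilon> \<delta> \<delta>] shift_close_join[OF Q P Q, of \<epsilon> \<delta> \<delta>]
  by (auto simp: O_set_iff)

lemma O_set_downward:
  assumes "\<delta> \<in> O_set X dX dY \<epsilon> P Q" "0 < \<delta>'" "\<delta>' \<le> \<delta>"
  shows "\<delta>' \<in> O_set X dX dY \<epsilon> P Q"
  using assms O_set_imp_self[OF assms(1)]
    shift_close_join[OF P Q Q, of \<epsilon> \<delta> \<delta>'] shift_close_join[OF Q P P, of \<epsilon> \<delta> \<delta>']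
  by (auto simp: O_set_iff)

text \<open>
  For the converse, decrease the two admissibility shifts to a common \<open>\<delta>\<close> and pass from \<open>P B\<close> to
  \<open>Q (B\<^sup>\<delta>)\<close> through \<open>P (B\<^sup>\<delta>)\<close>. By the strong triangle inequality the errors do not add up.
\<close>

lemma O_set_nonempty_iff:
  "O_set X dX dY \<epsilon> P Q \<noteq> {} \<longleftrightarrow>
     rho_s X dX dY P Q \<le> ennreal \<epsilon> \<and> admissible X dX dY \<epsilon> P \<and> admissible X dX dY \<epsilon> Q"
    (is "?L \<longleftrightarrow> ?R")
proof
  assume ?L
  then obtain \<delta> where \<delta>: "\<delta> \<in> O_set X dX dY \<epsilon> P Q" by blast
  note self = O_set_imp_self[OF \<delta>]
  have "dY (P B) (Q B) \<le> ennreal \<epsilon>" if "B \<in> metric_balls X dX" for B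
    using dist_le_of_shift_close[OF P Q Q _ self(2) _ that] \<delta> by (auto simp: O_set_iff)
  then show ?R
    using self \<delta> unfolding rho_s_def admissible_iff by (auto simp: O_set_iff intro: SUP_least)
next
  assume R: ?R
  then obtain \<delta>1 \<delta>2 where \<delta>: "0 < \<delta>1" "shift_close \<epsilon> \<delta>1 P P" "0 < \<delta>2" "shift_close \<epsilon> \<delta>2 Q Q"
    unfolding admissible_iff by blast
  define \<delta> where "\<delta> = min \<delta>1 \<delta>2"
  have "0 < \<delta>" using \<delta> by (simp add: \<delta>_def)
  have self: "shift_close \<epsilon> \<delta> P P" "shift_close \<epsilon> \<delta> Q Q"
    using \<delta> shift_close_join[OF P P P, of \<epsilon> \<delta>1 \<delta>] shift_close_join[OF Q Q Q, of \<epsilon> \<delta>2 \<delta>]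
    by (auto simp: \<delta>_def)
  have PQ: "dY (P B) (Q B) \<le> ennreal \<epsilon>" if "B \<in> metric_balls X dX" for B
    using R that unfolding rho_s_def by (auto simp: SUP_le_iff)
  have "shift_close \<epsilon> \<delta> P Q \<and> shift_close \<epsilon> \<delta> Q P"
    unfolding shift_close_def
  proof (intro conjI ballI)
    fix B assume B: "B \<in> metric_balls X dX"
    have C: "enlarge X dX B \<delta> \<in> metric_balls X dX" (is "?C \<in> _")
      using X.enlarge_in_metric_balls B \<open>0 < \<delta>\<close> by blast
    have "dY (P B) (Q ?C) \<le> max (dY (P B) (P ?C)) (dY (P ?C) (Q ?C))"
      using Y.strong_triangle ball_map_in P Q B C by blast
    then show "dY (P B) (Q ?C) \<le> ennreal \<epsilon>"
      using self(1) PQ[OF C] B unfolding shift_close_def by (meson max.boundedI order_trans)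
    have "dY (Q B) (P ?C) \<le> max (dY (Q B) (Q ?C)) (dY (Q ?C) (P ?C))"
      using Y.strong_triangle ball_map_in P Q B C by blast
    moreover have "dY (Q ?C) (P ?C) = dY (P ?C) (Q ?C)"
      using Y.sym ball_map_in P Q C by blast
    ultimately show "dY (Q B) (P ?C) \<le> ennreal \<epsilon>"
      using self(2) PQ[OF C] B unfolding shift_close_def by (metis max.boundedI order_trans)
  qed
  then show ?L using \<open>0 < \<delta>\<close> O_set_iff by blast
qed

end

section \<open>The unstarred distances\<close>

lemma ennreal_real_between:
  fixes x y :: ennreal
  assumes "x < y"
  obtains e :: real where "0 < e" "x < ennreal e" "ennreal e < y"
proof -
  obtain z where z: "x < z" "z < y" using dense[OF assms] by blast
  then obtain e where e: "z = ennreal e" by (cases z) auto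
  have "x < ennreal e" using z(1) e by simp
  then have "0 < ennreal e" by (rule le_less_trans[OF zero_le])
  then have "0 < e" by simp
  then show ?thesis using that[of e] z e by simp
qed

lemma ennreal_le_by_real_above:
  fixes x y :: ennreal
  assumes "\<And>e::real. \<lbrakk>0 < e; x < ennreal e\<rbrakk> \<Longrightarrow> y \<le> ennreal e"
  shows "y \<le> x"
proof (rule ccontr)
  assume "\<not> y \<le> x"
  then have "x < y" by simp
  then obtain e where "0 < e" "x < ennreal e" "ennreal e < y"
    by (rule ennreal_real_between)
  then show False using assms[of e] by simp
qed

lemma ennreal_top_of_unbounded:
  fixes x :: ennreal
  assumes "\<And>K::real. ennreal K \<le> x"
  shows "x = top"
proof (cases x)
  case (real K)
  with assms[of "K + 1"] show ?thesis by simp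
qed

context ball_map_pair
begin

text \<open>
  Every \<open>\<epsilon>\<close> with \<open>O\<^sub>\<epsilon> \<noteq> {}\<close> is attained by some \<open>\<lambda>\<close>, namely \<open>\<lambda> = \<delta> / \<epsilon>\<close> for \<open>\<delta> \<in> O\<^sub>\<epsilon>\<close>.
\<close>

lemma beta_0_eq_Inf_nonempty:
  "beta_0 X dX dY P Q = (INF \<epsilon>\<in>{\<epsilon>. 0 < \<epsilon> \<and> O_set X dX dY \<epsilon> P Q \<noteq> {}}. ennreal \<epsilon>)"
proof (rule antisym)
  show "beta_0 X dX dY P Q \<le> (INF \<epsilon>\<in>{\<epsilon>. 0 < \<epsilon> \<and> O_set X dX dY \<epsilon> P Q \<noteq> {}}. ennreal \<epsilon>)"
  proof (rule INF_greatest)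
    fix \<epsilon> assume "\<epsilon> \<in> {\<epsilon>. 0 < \<epsilon> \<and> O_set X dX dY \<epsilon> P Q \<noteq> {}}"
    then obtain \<delta> where \<epsilon>: "0 < \<epsilon>" and \<delta>: "\<delta> \<in> O_set X dX dY \<epsilon> P Q" by blast
    have pos: "0 < \<delta> / \<epsilon>" using \<epsilon> \<delta> by (simp add: O_set_iff)
    have "beta_0 X dX dY P Q \<le> beta X dX dY (\<delta> / \<epsilon>) P Q"
      unfolding beta_0_def using pos by (intro INF_lower) simp
    also have "\<dots> \<le> ennreal \<epsilon>"
      unfolding beta_eq[OF pos] using \<epsilon> \<delta> by (intro INF_lower) simp
    finally show "beta_0 X dX dY P Q \<le> ennreal \<epsilon>" .
  qed
  show "(INF \<epsilon>\<in>{\<epsilon>. 0 < \<epsilon> \<and> O_set X dX dY \<epsilon> P Q \<noteq> {}}. ennreal \<epsilon>) \<le> beta_0 X dX dY P Q"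
    unfolding beta_0_def by (intro INF_greatest) (auto simp: beta_eq intro!: INF_superset_mono)
qed

proposition beta_0_eq_max:
  "beta_0 X dX dY P Q = max (rho_s X dX dY P Q) (max (d_a X dX dY P) (d_a X dX dY Q))"
    (is "_ = ?m")
proof (rule antisym)
  show "?m \<le> beta_0 X dX dY P Q"
    unfolding beta_0_eq_Inf_nonempty O_set_nonempty_iff d_a_def
    by (intro INF_greatest) (auto intro: INF_lower)
  have admissible_above: "admissible X dX dY e R" if "d_a X dX dY R < ennreal e" for e R
  proof -
    obtain \<epsilon> where "admissible X dX dY \<epsilon> R" "ennreal \<epsilon> < ennreal e"
      using \<open>d_a X dX dY R < ennreal e\<close> unfolding d_a_def INF_less_iff by blast
    then show ?thesis
      by (metis admissible_mono ennreal_leI leD linear)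
  qed
  show "beta_0 X dX dY P Q \<le> ?m"
  proof (rule ennreal_le_by_real_above)
    fix e :: real assume "0 < e" "?m < ennreal e"
    then have "O_set X dX dY e P Q \<noteq> {}"
      unfolding O_set_nonempty_iff by (auto intro: admissible_above)
    then show "beta_0 X dX dY P Q \<le> ennreal e"
      unfolding beta_0_eq_Inf_nonempty using \<open>0 < e\<close> by (intro INF_lower) simp
  qed
qed

lemma rho_s_pos:
  assumes "P \<noteq> Q"
  shows "0 < rho_s X dX dY P Q"
proof -
  obtain B where "P B \<noteq> Q B" using \<open>P \<noteq> Q\<close> by blast
  \<comment> \<open>Elements of \<open>ball_maps\<close> agree on sets that are not balls.\<close>
  then have B: "B \<in> metric_balls X dX"
    using P Q unfolding ball_maps_def by (metis PiE_arb)
  then have "dY (P B) (Q B) \<noteq> 0"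
    using Y.zero_iff ball_map_in P Q \<open>P B \<noteq> Q B\<close> by blast
  then have "0 < dY (P B) (Q B)" by (simp add: zero_less_iff_neq_zero)
  also have "\<dots> \<le> rho_s X dX dY P Q"
    unfolding rho_s_def using B by (rule SUP_upper)
  finally show ?thesis .
qed

text \<open>
  The hypothesis excludes \<open>\<rho>\<^sub>s = 0\<close>, and hence sequences of \<open>\<epsilon>\<close> that tend to \<open>0\<close> so fast that \<open>\<lambda>\<epsilon>\<close>
  stays bounded as \<open>\<lambda>\<close> grows.
\<close>

proposition beta_inf_eq_Omega_hat:
  assumes "P \<noteq> Q"
  shows "beta_inf X dX dY P Q = Omega_hat X dX dY P Q"
proof (rule antisym)
  have "beta X dX dY lam P Q \<le> ennreal \<epsilon>"
    if "0 < lam" "0 < \<epsilon>" and top: "Omega_eps X dX dY \<epsilon> P Q = top" for lam \<epsilon>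
  proof -
    have "ennreal (lam * \<epsilon>) < Omega_eps X dX dY \<epsilon> P Q"
      unfolding top by simp
    then obtain \<delta> where "\<delta> \<in> O_set X dX dY \<epsilon> P Q" "ennreal (lam * \<epsilon>) < ennreal \<delta>"
      unfolding Omega_eps_def less_SUP_iff by blast
    then have "lam * \<epsilon> \<in> O_set X dX dY \<epsilon> P Q"
      using O_set_downward that(1,2) by (simp add: ennreal_less_iff)
    then show ?thesis
      unfolding beta_eq[OF \<open>0 < lam\<close>] using \<open>0 < \<epsilon>\<close> by (intro INF_lower) simp
  qed
  then show "beta_inf X dX dY P Q \<le> Omega_hat X dX dY P Q"
    unfolding beta_inf_def Omega_hat_def by (auto intro!: SUP_least INF_greatest)
  obtain c where c: "0 < c" "ennreal c < rho_s X dX dY P Q"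
    using rho_s_pos[OF assms] by (rule ennreal_real_between)
  show "Omega_hat X dX dY P Q \<le> beta_inf X dX dY P Q"
  proof (rule ennreal_le_by_real_above)
    fix e :: real assume e: "0 < e" "beta_inf X dX dY P Q < ennreal e"
    have "ennreal K \<le> Omega_eps X dX dY e P Q" for K
    proof -
      \<comment> \<open>This \<open>\<lambda>\<close> makes \<open>\<lambda>\<epsilon> \<ge> K\<close> for every \<open>\<epsilon> \<ge> c\<close>.\<close>
      define lam where "lam = max 1 (K / c)"
      have lam: "1 \<le> lam" by (simp add: lam_def)
      have "beta X dX dY lam P Q \<le> beta_inf X dX dY P Q"
        unfolding beta_inf_def using lam by (intro SUP_upper) simp
      then have "beta X dX dY lam P Q < ennreal e" using e(2) by simp
      then obtain \<epsilon> where \<epsilon>: "0 < \<epsilon>" "lam * \<epsilon> \<in> O_set X dX dY \<epsilon> P Q" "ennreal \<epsilon> < ennreal e"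
        using lam by (auto simp: beta_eq INF_less_iff)
      have "rho_s X dX dY P Q \<le> ennreal \<epsilon>" using O_set_nonempty_iff[of \<epsilon>] \<epsilon>(2) by blast
      then have "ennreal c < ennreal \<epsilon>" using c(2) by (rule order_less_le_trans[rotated])
      then have "c \<le> \<epsilon>" using c(1) by (simp add: ennreal_less_iff)
      have "K = (K / c) * c" using c(1) by simp
      also have "\<dots> \<le> lam * c" using c(1) by (intro mult_right_mono) (auto simp: lam_def)
      also have "\<dots> \<le> lam * \<epsilon>" using \<open>c \<le> \<epsilon>\<close> lam by (intro mult_left_mono) auto
      finally have "ennreal K \<le> ennreal (lam * \<epsilon>)" by (rule ennreal_leI)
      moreover have "lam * \<epsilon> \<in> O_set X dX dY e P Q"
        using O_set_mono[OF \<epsilon>(2)] \<epsilon>(1,3) by (simp add: ennreal_less_iff)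
      ultimately show ?thesis
        unfolding Omega_eps_def by (meson SUP_upper order_trans)
    qed
    then have "Omega_eps X dX dY e P Q = top"
      by (rule ennreal_top_of_unbounded)
    then show "Omega_hat X dX dY P Q \<le> ennreal e"
      unfolding Omega_hat_def using e(1) by (intro INF_lower) simp
  qed
qed

section \<open>The starred distances\<close>

text \<open>
  For the lower bound fix a ball \<open>B\<close> of radius \<open>r\<close>. With \<open>\<lambda> = r / e\<close>, no enlargement that is allowed
  for an \<open>\<epsilon> < e\<close> changes \<open>B\<close>.
\<close>

proposition beta_star_0_eq_rho_s: "beta_star_0 X dX dY P Q = rho_s X dX dY P Q"
proof (rule antisym)
  have sym: "dY (Q B) (P B) = dY (P B) (Q B)" if "B \<in> metric_balls X dX" for B
    using Y.sym ball_map_in P Q that by blast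
  have "beta_star X dX dY lam P Q \<le> rho_s X dX dY P Q" if lam: "0 < lam" for lam
  proof (rule ennreal_le_by_real_above)
    fix e :: real assume e: "0 < e" "rho_s X dX dY P Q < ennreal e"
    have "\<exists>\<eta> \<eta>'. 0 < \<eta> \<and> \<eta> \<le> e \<and> 0 < \<eta>' \<and> \<eta>' \<le> e \<and>
          dY (P B) (Q (enlarge X dX B (lam * \<eta>))) \<le> ennreal e \<and>
          dY (Q B) (P (enlarge X dX B (lam * \<eta>'))) \<le> ennreal e"
      if B: "B \<in> metric_balls X dX" for B
    proof -
      obtain r where r: "0 < r" "\<And>\<epsilon>. \<lbrakk>0 < \<epsilon>; \<epsilon> \<le> r\<rbrakk> \<Longrightarrow> enlarge X dX B \<epsilon> = B"
        using X.enlarge_small_eq[OF B] by blast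
      define \<eta> where "\<eta> = min e (r / lam)"
      have \<eta>: "0 < \<eta>" "\<eta> \<le> e" "\<eta> \<le> r / lam" using e(1) r(1) lam by (auto simp: \<eta>_def)
      have "lam * \<eta> \<le> r" using \<eta>(3) lam by (simp add: pos_le_divide_eq mult.commute)
      then have "enlarge X dX B (lam * \<eta>) = B" using r(2) \<eta>(1) lam by simp
      moreover have "dY (P B) (Q B) \<le> ennreal e"
        using e(2) B unfolding rho_s_def by (meson SUP_upper less_imp_le order_trans)
      ultimately show ?thesis using \<eta>(1,2) sym[OF B] by (intro exI[of _ \<eta>]) simp
    qed
    then show "beta_star X dX dY lam P Q \<le> ennreal e"
      unfolding beta_star_def using e(1) by (intro INF_lower) simp
  qed
  then show "beta_star_0 X dX dY P Q \<le> rho_s X dX dY P Q"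
    unfolding beta_star_0_def by (auto intro: SUP_least)
  show "rho_s X dX dY P Q \<le> beta_star_0 X dX dY P Q"
    unfolding rho_s_def
  proof (rule SUP_least, rule ennreal_le_by_real_above)
    fix B and e :: real
    assume B: "B \<in> metric_balls X dX" and e: "0 < e" "beta_star_0 X dX dY P Q < ennreal e"
    obtain r where r: "0 < r" "\<And>\<epsilon>. \<lbrakk>0 < \<epsilon>; \<epsilon> \<le> r\<rbrakk> \<Longrightarrow> enlarge X dX B \<epsilon> = B"
      using X.enlarge_small_eq[OF B] by blast
    define lam where "lam = r / e"
    have lam: "0 < lam" "lam * e = r" using r(1) e(1) by (auto simp: lam_def)
    have "beta_star X dX dY lam P Q \<le> beta_star_0 X dX dY P Q"
      unfolding beta_star_0_def using lam by (intro SUP_upper) simp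
    then have "beta_star X dX dY lam P Q < ennreal e" using e(2) by simp
    then obtain \<epsilon> \<eta> where \<epsilon>: "ennreal \<epsilon> < ennreal e" and \<eta>: "0 < \<eta>" "\<eta> \<le> \<epsilon>"
      and close: "dY (P B) (Q (enlarge X dX B (lam * \<eta>))) \<le> ennreal \<epsilon>"
      unfolding beta_star_def INF_less_iff using B by blast
    have "\<eta> \<le> e" using \<epsilon> \<eta> by (simp add: ennreal_less_iff)
    then have "lam * \<eta> \<le> lam * e" using lam(1) by (intro mult_left_mono) auto
    then have "enlarge X dX B (lam * \<eta>) = B" using r(2) lam \<eta>(1) by simp
    then show "dY (P B) (Q B) \<le> ennreal e" using close \<epsilon> by simp
  qed
qed

lemma beta_star_eq:
  assumes "0 < lam"
  shows "beta_star X dX dY lam P Q =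
    (INF \<epsilon>\<in>{\<epsilon>. 0 < \<epsilon> \<and> lam * \<epsilon> \<in> O_star X dX dY \<epsilon> P Q \<inter> O_star X dX dY \<epsilon> Q P}. ennreal \<epsilon>)"
proof -
  have rescale: "(\<exists>\<eta>. 0 < \<eta> \<and> \<eta> \<le> \<epsilon> \<and> R (lam * \<eta>)) \<longleftrightarrow> (\<exists>\<delta>. 0 < \<delta> \<and> \<delta> \<le> lam * \<epsilon> \<and> R \<delta>)"
    for R \<epsilon>
  proof
    assume "\<exists>\<eta>. 0 < \<eta> \<and> \<eta> \<le> \<epsilon> \<and> R (lam * \<eta>)"
    then obtain \<eta> where "0 < \<eta>" "\<eta> \<le> \<epsilon>" "R (lam * \<eta>)" by blast
    then show "\<exists>\<delta>. 0 < \<delta> \<and> \<delta> \<le> lam * \<epsilon> \<and> R \<delta>"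
      using assms by (intro exI[of _ "lam * \<eta>"]) simp
  next
    assume "\<exists>\<delta>. 0 < \<delta> \<and> \<delta> \<le> lam * \<epsilon> \<and> R \<delta>"
    then obtain \<delta> where "0 < \<delta>" "\<delta> \<le> lam * \<epsilon>" "R \<delta>" by blast
    then show "\<exists>\<eta>. 0 < \<eta> \<and> \<eta> \<le> \<epsilon> \<and> R (lam * \<eta>)"
      using assms by (intro exI[of _ "\<delta> / lam"]) (auto simp: pos_divide_le_eq mult.commute)
  qed
  have split: "(\<exists>\<eta> \<eta>'. 0 < \<eta> \<and> \<eta> \<le> \<epsilon> \<and> 0 < \<eta>' \<and> \<eta>' \<le> \<epsilon> \<and> R \<eta> \<and> S \<eta>') \<longleftrightarrow>
      (\<exists>\<eta>. 0 < \<eta> \<and> \<eta> \<le> \<epsilon> \<and> R \<eta>) \<and> (\<exists>\<eta>. 0 < \<eta> \<and> \<eta> \<le> \<epsilon> \<and> S \<eta>)" for R S and \<epsilon> :: real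
    by blast
  show ?thesis
    unfolding beta_star_def O_star_def split
      rescale[of _ "\<lambda>\<delta>. dY (P _) (Q (enlarge X dX _ \<delta>)) \<le> _"]
      rescale[of _ "\<lambda>\<delta>. dY (Q _) (P (enlarge X dX _ \<delta>)) \<le> _"]
    by (rule arg_cong[where f = Inf], rule image_cong) (use assms in auto)
qed

proposition beta_star_inf_eq_Omega_star:
  "beta_star_inf X dX dY P Q = Omega_star X dX dY P Q"
proof (rule antisym)
  show "beta_star_inf X dX dY P Q \<le> Omega_star X dX dY P Q"
    unfolding Omega_star_def
  proof (rule INF_greatest)
    fix \<epsilon> assume "\<epsilon> \<in> {\<epsilon>. 0 < \<epsilon> \<and> O_star X dX dY \<epsilon> P Q \<inter> O_star X dX dY \<epsilon> Q P \<noteq> {}}"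
    then obtain \<delta> where \<epsilon>: "0 < \<epsilon>"
      and \<delta>: "\<delta> \<in> O_star X dX dY \<epsilon> P Q \<inter> O_star X dX dY \<epsilon> Q P" by blast
    have pos: "0 < \<delta> / \<epsilon>" using \<epsilon> \<delta> by (simp add: O_star_def)
    have "beta_star_inf X dX dY P Q \<le> beta_star X dX dY (\<delta> / \<epsilon>) P Q"
      unfolding beta_star_inf_def using pos by (intro INF_lower) simp
    also have "\<dots> \<le> ennreal \<epsilon>"
      unfolding beta_star_eq[OF pos] using \<epsilon> \<delta> by (intro INF_lower) simp
    finally show "beta_star_inf X dX dY P Q \<le> ennreal \<epsilon>" .
  qed
  show "Omega_star X dX dY P Q \<le> beta_star_inf X dX dY P Q"
    unfolding beta_star_inf_def Omega_star_def
    by (intro INF_greatest) (auto simp: beta_star_eq intro!: INF_superset_mono)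
qed

end

section \<open>The comparison theorem\<close>

theorem theorem4p6:
  fixes X :: "'a set" and dX :: "'a \<Rightarrow> 'a \<Rightarrow> ennreal"
    and Y :: "'b set" and dY :: "'b \<Rightarrow> 'b \<Rightarrow> ennreal"
    and P1 P2 :: "'a set \<Rightarrow> 'b"
  assumes "nonarch_metric_space X dX"
    and "nonarch_metric_space Y dY"
    and "\<forall>B\<in>metric_balls X dX. \<exists>x\<in>B. \<exists>y\<in>B. x \<noteq> y"
    and "\<forall>B\<in>metric_balls Y dY. \<exists>x\<in>B. \<exists>y\<in>B. x \<noteq> y"
    and "P1 \<in> ball_maps X dX Y"
    and "P2 \<in> ball_maps X dX Y"
    and "P1 \<noteq> P2"
  shows "(beta_0 X dX dY P1 P2 = rho_s X dX dY P1 P2 \<longleftrightarrow>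
            max (d_a X dX dY P1) (d_a X dX dY P2) \<le> rho_s X dX dY P1 P2)
       \<and> beta_inf X dX dY P1 P2 = Omega_hat X dX dY P1 P2
       \<and> beta_star_0 X dX dY P1 P2 = rho_s X dX dY P1 P2
       \<and> beta_star_inf X dX dY P1 P2 = Omega_star X dX dY P1 P2"
proof -
  interpret ball_map_pair X dX Y dY P1 P2
    using assms by (simp add: ball_map_pair_def ball_map_pair_axioms_def ball_map_setting_def)
  have "beta_0 X dX dY P1 P2 = rho_s X dX dY P1 P2 \<longleftrightarrow>
      max (d_a X dX dY P1) (d_a X dX dY P2) \<le> rho_s X dX dY P1 P2"
    unfolding beta_0_eq_max by (metis max.absorb1 max.cobounded2)
  then show ?thesis
    using beta_inf_eq_Omega_hat[OF assms(7)] beta_star_0_eq_rho_s beta_star_inf_eq_Omega_star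
    by blast
qed

end
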